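(* Let $f,\psi:[0,\infty)\to\mathbb{R}$ be two functions such that $\psi$ is positive, increasing, and $\psi(t)\to\infty$ as $t\to\infty$. If $$\frac{f(t)}{\psi(t)}\longrightarrow 0\quad\text{as } t\to\infty,$$ then $$\frac{R_t(f)}{\psi(t)}\longrightarrow 0\quad\text{as } t\to\infty.$$
   Context: For a function $f:[0,\infty)\to\mathbb{R}$ and $t\ge 0$, the range of $f$ up to time $t$ is $R_t(f)=\sup_{0\le s\le t}f(s)-\inf_{0\le s\le t}f(s)$.
   Formalization: The function f is additionally assumed bounded on every interval [0,t], so that R_t(f) is finite; without this the claim fails, e.g. for ψ(t)=1+t, f(0)=0, f(t)=1/t for t>0, where R_t(f)=∞ for all t>0. *)

theory Defs
  imports Complex_Main
begin

(* The range of f up to time t. The library's SUP and INF on the reals are unspecified on unbounded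
   sets, so for t \<ge> 0 this is the range exactly when f is bounded on {0..t}. *)
definition range_upto :: "(real \<Rightarrow> real) \<Rightarrow> real \<Rightarrow> real" where
  "range_upto f t = (SUP s\<in>{0..t}. f s) - (INF s\<in>{0..t}. f s)"

end

theory Submission
  imports Defs
begin

text \<open>
  Fix \<open>\<epsilon> > 0\<close>. From some time \<open>T\<close> on, the hypothesis gives \<open>\<bar>f s\<bar> \<le> \<epsilon> \<psi> s\<close>, and monotonicity of
  \<open>\<psi>\<close> turns this into \<open>\<bar>f s\<bar> \<le> \<epsilon> \<psi> t\<close> for every later \<open>t\<close>. Before \<open>T\<close> the function is bounded by a
  constant, which \<open>\<epsilon> \<psi> t\<close> exceeds as soon as \<open>t\<close> is large, since \<open>\<psi>\<close> is unbounded. So for large \<open>t\<close>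
  the whole path up to time \<open>t\<close> lies in the band of half-width \<open>\<epsilon> \<psi> t\<close> around \<open>0\<close>
  (\<open>eventually_path_le\<close>), and its range is at most the width of that band
  (\<open>range_upto_le\<close>).
\<close>

lemma range_upto_nonneg:
  assumes "0 \<le> t" "bdd_above (f ` {0..t})" "bdd_below (f ` {0..t})"
  shows "0 \<le> range_upto f t"
proof -
  have "(INF s\<in>{0..t}. f s) \<le> f 0"
    using assms by (intro cINF_lower) auto
  also have "f 0 \<le> (SUP s\<in>{0..t}. f s)"
    using assms by (intro cSUP_upper) auto
  finally show ?thesis
    by (simp add: range_upto_def)
qed

lemma range_upto_le:
  assumes "0 \<le> t" and B: "\<And>s. s \<in> {0..t} \<Longrightarrow> \<bar>f s\<bar> \<le> B"
  shows "range_upto f t \<le> 2 * B"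
proof -
  have "(SUP s\<in>{0..t}. f s) \<le> B"
    using assms by (intro cSUP_least) (auto simp: abs_le_iff)
  moreover have "- B \<le> (INF s\<in>{0..t}. f s)"
  proof (rule cINF_greatest)
    show "- B \<le> f s" if "s \<in> {0..t}" for s
      using B[OF that] by linarith
  qed (use \<open>0 \<le> t\<close> in simp)
  ultimately show ?thesis
    by (simp add: range_upto_def)
qed

text \<open>
  The hypothesis compares \<open>f s\<close> with \<open>\<psi>\<close> at the same time \<open>s\<close>; the range needs a comparison of the
  whole past with \<open>\<psi>\<close> at the present time \<open>t\<close>. The recent past is covered by monotonicity of \<open>\<psi>\<close>,
  the remote past by its divergence.
\<close>

lemma eventually_path_le:
  fixes f \<psi> :: "real \<Rightarrow> real"
  assumes bdd: "\<And>t. 0 \<le> t \<Longrightarrow> bdd_above (f ` {0..t}) \<and> bdd_below (f ` {0..t})"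
    and pos: "\<And>t. 0 \<le> t \<Longrightarrow> 0 < \<psi> t"
    and incr: "mono_on {0..} \<psi>"
    and unbounded: "filterlim \<psi> at_top at_top"
    and small: "((\<lambda>t. f t / \<psi> t) \<longlongrightarrow> 0) at_top"
    and "0 < \<epsilon>"
  shows "\<forall>\<^sub>F t in at_top. \<forall>s\<in>{0..t}. \<bar>f s\<bar> \<le> \<epsilon> * \<psi> t"
proof -
  have "\<forall>\<^sub>F s in at_top. \<bar>f s / \<psi> s\<bar> < \<epsilon>"
    using tendstoD[OF small \<open>0 < \<epsilon>\<close>] by (simp add: dist_real_def)
  then obtain T0 where T0: "\<And>s. T0 \<le> s \<Longrightarrow> \<bar>f s / \<psi> s\<bar> < \<epsilon>"
    by (auto simp: eventually_at_top_linorder)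
  define T where "T = max 0 T0"
  have recent: "\<bar>f s\<bar> \<le> \<epsilon> * \<psi> s" if "T \<le> s" for s
    using T0[of s] pos[of s] that by (simp add: T_def abs_divide pos_divide_less_eq)
  obtain b where b: "\<forall>s\<in>{0..T}. f s \<le> b"
    using bdd[of T] by (auto simp: T_def bdd_above_def)
  obtain a where a: "\<forall>s\<in>{0..T}. a \<le> f s"
    using bdd[of T] by (auto simp: T_def bdd_below_def)
  define M where "M = max \<bar>a\<bar> \<bar>b\<bar>"
  have remote: "\<bar>f s\<bar> \<le> M" if "s \<in> {0..T}" for s
    using a b that by (fastforce simp: M_def)
  have "\<forall>\<^sub>F t in at_top. M / \<epsilon> \<le> \<psi> t"
    using unbounded by (simp add: filterlim_at_top)
  with eventually_ge_at_top[of T] show ?thesis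
  proof eventually_elim
    case (elim t)
    show ?case
    proof
      fix s assume s: "s \<in> {0..t}"
      show "\<bar>f s\<bar> \<le> \<epsilon> * \<psi> t"
      proof (cases "s \<le> T")
        case True
        then have "\<bar>f s\<bar> \<le> M"
          using remote s by simp
        also have "M \<le> \<epsilon> * \<psi> t"
          using elim(2) \<open>0 < \<epsilon>\<close> by (simp add: pos_divide_le_eq mult.commute)
        finally show ?thesis .
      next
        case False
        then have "\<bar>f s\<bar> \<le> \<epsilon> * \<psi> s"
          using recent by simp
        also have "\<psi> s \<le> \<psi> t"
          using s by (intro mono_onD[OF incr]) auto
        finally show ?thesis
          using \<open>0 < \<epsilon>\<close> by simp
      qed
    qed
  qed
qed

theorem theorem3:
  fixes f \<psi> :: "real \<Rightarrow> real"
  assumes range_finite: "\<And>t. 0 \<le> t \<Longrightarrow> bdd_above (f ` {0..t}) \<and> bdd_below (f ` {0..t})"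
    and psi_pos: "\<And>t. 0 \<le> t \<Longrightarrow> 0 < \<psi> t"
    and psi_incr: "mono_on {0..} \<psi>"
    and psi_unbounded: "filterlim \<psi> at_top at_top"
    and f_small: "((\<lambda>t. f t / \<psi> t) \<longlongrightarrow> 0) at_top"
  shows "((\<lambda>t. range_upto f t / \<psi> t) \<longlongrightarrow> 0) at_top"
proof (rule tendstoI)
  fix e :: real assume "0 < e"
  \<comment> \<open>A band of half-width \<open>e / 3 * \<psi> t\<close> has width strictly below \<open>e * \<psi> t\<close>.\<close>
  then have "\<forall>\<^sub>F t in at_top. \<forall>s\<in>{0..t}. \<bar>f s\<bar> \<le> e / 3 * \<psi> t"
    by (intro eventually_path_le[OF assms]) simp_all
  with eventually_ge_at_top[of 0]
  show "\<forall>\<^sub>F t in at_top. dist (range_upto f t / \<psi> t) 0 < e"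
  proof eventually_elim
    case (elim t)
    have pos: "0 < \<psi> t"
      using psi_pos elim(1) .
    have "range_upto f t \<le> 2 * (e / 3 * \<psi> t)"
      using elim by (intro range_upto_le) auto
    also have "\<dots> < e * \<psi> t"
      using pos \<open>0 < e\<close> by simp
    finally have "range_upto f t < e * \<psi> t" .
    moreover have "0 \<le> range_upto f t"
      using range_finite[OF elim(1)] elim(1) by (intro range_upto_nonneg) auto
    ultimately show ?case
      using pos by (simp add: dist_real_def abs_divide pos_divide_less_eq)
  qed
qed

end
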